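(* For $r=1,2$ let $X_r$ be a Banach space with a shrinking basis $(e_k^r)_{k=1}^\infty$, and assume that $X_r$ satisfies the $(d_r,N_r,P_r,\mathbf{a})$ distortion property (with respect to $(e_k^r)_k$), where $\mathbf{a}=(\delta_i)$ is the same sequence for $r=1,2$ and satisfies $\lim_i\frac{\delta_{i+1}}{\delta_i}=0$. Write $N_r=(n_k^r)_{k=1}^\infty$, $r=1,2$. Suppose that for every $i_0\in\mathbb{N}$ there exist $i>j>i_0$ such that $n_i^1=n_j^2$. Then $X_1$ and $X_2$ are totally incomparable.
   Context: All Banach spaces are real and infinite dimensional; a subspace means an infinite dimensional closed linear subspace. $X$ and $Y$ are totally incomparable if no subspace of $X$ is isomorphic to a subspace of $Y$. Schreier families: $S_0=\{\{n\}:n\in\mathbb{N}\}\cup\{\emptyset\}$ and, for $\xi<\omega$, $S_{\xi+1}=\{\bigcup_{i=1}^n F_i: n\in\mathbb{N},\ n\le\min F_1,\ F_1<\cdots<F_n,\ F_i\in S_\xi\ (i\le n)\}\cup\{\emptyset\}$, where $E<F$ means $\max E<\min F$. For a basis $(e_n)$ of $X$, a block basis of $(e_n)$ is a sequence of (non-zero) vectors $u_n=\sum_{i\in F_n}a_ie_i$ with $F_1<F_2<\cdots$ finite subsets of $\mathbb{N}$; a block subspace is the closed linear span of a block basis. A normalized sequence $(x_n)$ is an $\epsilon$-$\ell_1^\xi$ spreading model ($\epsilon>0$) if $\|\sum_{i\in F}a_ix_i\|\ge\epsilon\sum_{i\in F}|a_i|$ for every $F\in S_\xi$ and all scalars $(a_i)_{i\in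 F}$. A space $X$ with basis $(e_n)$ is asymptotic $\epsilon$-$\ell_1^\xi$ if every normalized block basis of $(e_n)$ is an $\epsilon$-$\ell_1^\xi$ spreading model. For $\delta>0$, $\tau(X,\delta)$ is the supremum of all $\zeta<\omega$ such that every normalized block basis of $(e_n)$ has a subsequence which is a $\delta$-$\ell_1^\zeta$ spreading model. For a block subspace $U$ of $X$, $\tau(U,\delta)$ is computed with respect to the block basis generating $U$. Distortion property: let $N=(n_i)$, $P=(p_i)$ be infinite subsets of $\mathbb{N}$ (enumerated increasingly) with $p_i<n_i/2$ for every $i\ge1$ and $n_{i-1}\le p_i$ for every $i\ge2$; let $\mathbf{a}=(\delta_i)$ be a decreasing null sequence of (positive) scalars and $d>1$. A space $X$ with basis $(e_i)$ satisfies the $(d,N,P,\mathbf{a})$ distortion property if for every $j\in\mathbb{N}$, $X$ is an asymptotic $\delta_j$-$\ell_1^{n_j}$ space and $\tau(U,d\delta_j)<p_j$ for every block subspace $U$ of $X$. *)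

theory Defs
  imports "HOL-Analysis.Analysis" "HOL-Library.Extended_Nat"
begin

text \<open>
  The positive integers index all sequences and carry the Schreier families, whose
  condition \<open>n \<le> min F\<^sub>1\<close> is sensitive to the indexing. A sequence
  \<open>x\<^sub>1, x\<^sub>2, \<dots>\<close> is a function on \<^typ>\<open>nat\<close> whose value at \<open>0\<close> is never used.
\<close>

definition schauder_basis :: "(nat \<Rightarrow> 'a::banach) \<Rightarrow> bool" where
  "schauder_basis e \<longleftrightarrow> (\<forall>x. \<exists>!a::nat \<Rightarrow> real. (\<lambda>k. a k *\<^sub>R e (Suc k)) sums x)"

text \<open>A bounded functional is determined by its values on a basis, so for a basis the
  following set consists exactly of the coordinate functionals.\<close>

definition biorthogonal_functionals :: "(nat \<Rightarrow> 'a::banach) \<Rightarrow> ('a \<Rightarrow>\<^sub>L real) set" where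
  "biorthogonal_functionals e =
     {f. \<exists>n\<ge>1. \<forall>m\<ge>1. blinfun_apply f (e m) = (if m = n then 1 else 0)}"

definition shrinking_basis :: "(nat \<Rightarrow> 'a::banach) \<Rightarrow> bool" where
  "shrinking_basis e \<longleftrightarrow>
     schauder_basis e \<and> closure (span (biorthogonal_functionals e)) = UNIV"

definition set_less :: "nat set \<Rightarrow> nat set \<Rightarrow> bool" where
  "set_less E F \<longleftrightarrow> Max E < Min F"

text \<open>\<open>Max\<close> and \<open>Min\<close> are meaningful only for finite nonempty sets; members of Schreier
  families are finite, and the pieces \<open>F i\<close> are required to be nonempty.\<close>

fun schreier :: "nat \<Rightarrow> nat set set" where
  "schreier 0 = {{n} | n. n \<ge> 1} \<union> {{}}"
| "schreier (Suc \<xi>) =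
     {(\<Union>i\<in>{1..n}. F i) | n F.
        n \<ge> 1 \<and> n \<le> Min (F 1) \<and>
        (\<forall>i\<in>{1..n}. F i \<noteq> {} \<and> F i \<in> schreier \<xi>) \<and>
        (\<forall>i\<in>{1..<n}. set_less (F i) (F (Suc i)))} \<union> {{}}"

definition block_basis :: "(nat \<Rightarrow> 'a::real_normed_vector) \<Rightarrow> (nat \<Rightarrow> 'a) \<Rightarrow> bool" where
  "block_basis e u \<longleftrightarrow>
     (\<exists>(F :: nat \<Rightarrow> nat set) (a :: nat \<Rightarrow> real). \<forall>n\<ge>1.
        finite (F n) \<and> F n \<noteq> {} \<and> F n \<subseteq> {1..} \<and> set_less (F n) (F (Suc n)) \<and>
        u n = (\<Sum>i\<in>F n. a i *\<^sub>R e i) \<and> u n \<noteq> 0)"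

definition normalized :: "(nat \<Rightarrow> 'a::real_normed_vector) \<Rightarrow> bool" where
  "normalized x \<longleftrightarrow> (\<forall>n\<ge>1. norm (x n) = 1)"

definition l1_spreading_model ::
    "real \<Rightarrow> nat \<Rightarrow> (nat \<Rightarrow> 'a::real_normed_vector) \<Rightarrow> bool" where
  "l1_spreading_model \<epsilon> \<xi> x \<longleftrightarrow>
     \<epsilon> > 0 \<and> normalized x \<and>
     (\<forall>F\<in>schreier \<xi>. \<forall>a::nat \<Rightarrow> real.
        norm (\<Sum>i\<in>F. a i *\<^sub>R x i) \<ge> \<epsilon> * (\<Sum>i\<in>F. \<bar>a i\<bar>))"

definition asymptotic_l1 ::
    "real \<Rightarrow> nat \<Rightarrow> (nat \<Rightarrow> 'a::real_normed_vector) \<Rightarrow> bool" where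
  "asymptotic_l1 \<epsilon> \<xi> e \<longleftrightarrow>
     (\<forall>x. block_basis e x \<and> normalized x \<longrightarrow> l1_spreading_model \<epsilon> \<xi> x)"

text \<open>\<open>tau e \<delta>\<close> is \<open>\<tau>(X, \<delta>)\<close> computed with respect to the basis \<open>e\<close> of \<open>X\<close>. The supremum
  is taken in \<^typ>\<open>enat\<close>, so it is \<open>\<infinity>\<close> for an unbounded set and \<open>0\<close> for the empty set.\<close>

definition tau :: "(nat \<Rightarrow> 'a::real_normed_vector) \<Rightarrow> real \<Rightarrow> enat" where
  "tau e \<delta> =
     (SUP \<zeta>\<in>{\<zeta>::nat. \<forall>x. block_basis e x \<and> normalized x \<longrightarrow>
                 (\<exists>k::nat \<Rightarrow> nat. strict_mono k \<and> l1_spreading_model \<delta> \<zeta> (x \<circ> k))}. enat \<zeta>)"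

text \<open>The sets \<open>N\<close> and \<open>P\<close> are given by their increasing enumerations \<open>n\<close> and \<open>p\<close>. A block
  subspace enters only through the block basis \<open>u\<close> generating it.\<close>

definition distortion_property ::
    "real \<Rightarrow> (nat \<Rightarrow> nat) \<Rightarrow> (nat \<Rightarrow> nat) \<Rightarrow> (nat \<Rightarrow> real) \<Rightarrow> (nat \<Rightarrow> 'a::banach) \<Rightarrow> bool" where
  "distortion_property d n p \<delta> e \<longleftrightarrow>
     d > 1 \<and>
     strict_mono_on {1..} n \<and> strict_mono_on {1..} p \<and>
     (\<forall>i\<ge>1. n i \<ge> 1 \<and> p i \<ge> 1 \<and> real (p i) < real (n i) / 2) \<and>
     (\<forall>i\<ge>2. n (i - 1) \<le> p i) \<and>
     (\<forall>i\<ge>1. \<delta> i > 0) \<and> antimono_on {1..} \<delta> \<and> \<delta> \<longlonglongrightarrow> 0 \<and>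
     (\<forall>j\<ge>1. asymptotic_l1 (\<delta> j) (n j) e \<and>
             (\<forall>u. block_basis e u \<longrightarrow> tau u (d * \<delta> j) < enat (p j)))"

definition banach_subspace :: "'a::banach set \<Rightarrow> bool" where
  "banach_subspace V \<longleftrightarrow>
     subspace V \<and> closed V \<and> \<not> (\<exists>B. finite B \<and> span B = V)"

definition isomorphic_subspaces :: "'a::banach set \<Rightarrow> 'b::banach set \<Rightarrow> bool" where
  "isomorphic_subspaces V W \<longleftrightarrow>
     (\<exists>T S. (\<forall>x\<in>V. \<forall>y\<in>V. T (x + y) = T x + T y) \<and>
            (\<forall>c::real. \<forall>x\<in>V. T (c *\<^sub>R x) = c *\<^sub>R T x) \<and>
            homeomorphism V W T S)"

definition totally_incomparable :: "'a::banach itself \<Rightarrow> 'b::banach itself \<Rightarrow> bool" where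
  "totally_incomparable _ _ \<longleftrightarrow>
     \<not> (\<exists>(V :: 'a set) (W :: 'b set).
          banach_subspace V \<and> banach_subspace W \<and> isomorphic_subspaces V W)"

end

theory Submission
  imports Defs
begin

text \<open>
  Given an isomorphism \<open>T\<close> between subspaces of the two spaces, vectors of the first subspace can be
  chosen inductively so that finitely many initial coordinates vanish both for \<open>v\<close> and for \<open>T v\<close>.
  A small perturbation then yields a block basis \<open>u\<close> of \<open>e1\<close> that is equivalent to a block basis \<open>w\<close>
  of \<open>e2\<close>. If \<open>n1 i = n2 j\<close> with \<open>i > j\<close>, the asymptotic estimate for \<open>e2\<close> makes every
  normalized block basis of \<open>u\<close> a \<open>\<delta> j / C\<^sup>2\<close>-spreading model of order \<open>n1 i\<close>. For large \<open>j\<close> the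
  quotient \<open>\<delta> j / \<delta> i\<close> exceeds \<open>d1 * C\<^sup>2\<close>, so \<open>tau u (d1 * \<delta> i) \<ge> n1 i > p1 i\<close>, contrary to the
  distortion property of \<open>e1\<close>.
\<close>

section \<open>Linear combinations in the span of a family\<close>

lemma span_image_finite_sum:
  fixes f :: "'i \<Rightarrow> 'a::real_vector"
  assumes "x \<in> span (f ` I)"
  shows "\<exists>G c. finite G \<and> G \<subseteq> I \<and> x = (\<Sum>i\<in>G. c i *\<^sub>R f i)"
  using assms
proof (induction rule: span_induct_alt)
  case base
  show ?case by (rule exI[of _ "{}"]) simp
next
  case (step r y z)
  from step.IH step.hyps obtain G c i where G: "finite G" "G \<subseteq> I" "z = (\<Sum>i\<in>G. c i *\<^sub>R f i)"
    and i: "i \<in> I" "y = f i" by blast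
  \<comment> \<open>The index \<open>i\<close> may already lie in \<open>G\<close>, so the new
    coefficient is added to the old one instead of replacing it.\<close>
  define c' where "c' k = (if k \<in> G then c k else 0) + (if k = i then r else 0)" for k
  have "(\<Sum>k\<in>insert i G. c' k *\<^sub>R f k)
      = (\<Sum>k\<in>insert i G. (if k \<in> G then c k *\<^sub>R f k else 0)) + (\<Sum>k\<in>insert i G. if k = i then r *\<^sub>R f k else 0)"
    unfolding sum.distrib[symmetric] by (rule sum.cong) (auto simp: c'_def algebra_simps)
  also have "\<dots> = z + r *\<^sub>R y"
    using G i by (cases "i \<in> G") (auto simp: insert_absorb intro!: sum.cong)
  finally show ?case using G i by (intro exI[of _ "insert i G"] exI[of _ c']) auto
qed

lemma span_image_sum:
  fixes f :: "'i \<Rightarrow> 'a::real_vector"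
  assumes "finite I" and "x \<in> span (f ` I)"
  shows "\<exists>c. x = (\<Sum>i\<in>I. c i *\<^sub>R f i)"
proof -
  obtain G c where G: "finite G" "G \<subseteq> I" "x = (\<Sum>i\<in>G. c i *\<^sub>R f i)"
    using span_image_finite_sum[OF assms(2)] by blast
  have "x = (\<Sum>i\<in>I. (if i \<in> G then c i else 0) *\<^sub>R f i)"
    unfolding G(3) using G(1,2) assms(1) by (intro sum.mono_neutral_cong_left) auto
  then show ?thesis by (intro exI[of _ "\<lambda>i. if i \<in> G then c i else 0"])
qed

lemma sum_mem_span_image: "(\<And>i. i \<in> G \<Longrightarrow> i \<in> I) \<Longrightarrow> (\<Sum>i\<in>G. c i *\<^sub>R f i) \<in> span (f ` I)"
  by (intro span_sum span_scale span_base) auto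

section \<open>Block bases\<close>

lemma set_less_iff:
  assumes "finite A" "A \<noteq> {}" "finite B" "B \<noteq> {}"
  shows "set_less A B \<longleftrightarrow> (\<forall>a\<in>A. \<forall>b\<in>B. a < b)"
  using assms by (auto simp: set_less_def)

lemma set_less_chain:
  assumes F: "\<And>n. n \<ge> 1 \<Longrightarrow> finite (F n) \<and> F n \<noteq> {} \<and> set_less (F n) (F (Suc n))"
    and "1 \<le> i" "i < j"
  shows "\<forall>a\<in>F i. \<forall>b\<in>F j. a < b"
  using \<open>i < j\<close>
proof (induction j)
  case (Suc j)
  have S: "\<forall>a\<in>F j. \<forall>b\<in>F (Suc j). a < b" if "j \<ge> 1"
    using F[OF that] F[of "Suc j"] set_less_iff[of "F j" "F (Suc j)"] by simp
  show ?case
  proof (cases "i = j")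
    case True
    then show ?thesis using S assms(2) by simp
  next
    case False
    with Suc.prems have "i < j" by simp
    moreover obtain c where "c \<in> F j" using F[of j] \<open>i < j\<close> assms(2) by fastforce
    ultimately show ?thesis using Suc.IH S assms(2)
      by (meson dual_order.strict_trans le_trans less_imp_le)
  qed
qed simp

text \<open>The definition draws all blocks from one coefficient sequence. The sets
  \<open>F n\<close> are pairwise disjoint, so coefficients chosen for each block separately can be
  glued together. Span membership is the handier form when blocks are nested or obtained by
  approximation.\<close>

lemma block_basis_iff:
  "block_basis e u \<longleftrightarrow>
     (\<exists>F. \<forall>n\<ge>1. finite (F n) \<and> F n \<noteq> {} \<and> F n \<subseteq> {1..} \<and> set_less (F n) (F (Suc n)) \<and>
        u n \<in> span (e ` F n) \<and> u n \<noteq> 0)" (is "_ \<longleftrightarrow> (\<exists>F. ?P F)")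
proof
  assume "block_basis e u"
  then show "\<exists>F. ?P F"
    unfolding block_basis_def by (metis sum_mem_span_image)
next
  assume "\<exists>F. ?P F"
  then obtain F where F: "?P F" by blast
  have "\<forall>n. \<exists>c. n \<ge> 1 \<longrightarrow> u n = (\<Sum>i\<in>F n. c i *\<^sub>R e i)"
    using F span_image_sum by metis
  then obtain c where c: "\<And>n. n \<ge> 1 \<Longrightarrow> u n = (\<Sum>i\<in>F n. c n i *\<^sub>R e i)" by metis
  have unique: "m = n" if "m \<ge> 1" "n \<ge> 1" "i \<in> F m" "i \<in> F n" for m n i
    using set_less_chain[of F m n] set_less_chain[of F n m] F that
    by (metis less_irrefl nat_neq_iff)
  \<comment> \<open>Each index lies in at most one \<open>F n\<close> with \<open>n \<ge> 1\<close>,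
    so \<open>THE\<close> recovers its block; the value at an index outside all blocks is arbitrary
    and never read.\<close>
  define a where "a i = c (THE n. n \<ge> 1 \<and> i \<in> F n) i" for i
  have "a i = c n i" if "n \<ge> 1" "i \<in> F n" for n i
  proof -
    have "(THE n. n \<ge> 1 \<and> i \<in> F n) = n"
      using that unique by (intro the_equality) auto
    then show ?thesis by (simp add: a_def)
  qed
  then have "u n = (\<Sum>i\<in>F n. a i *\<^sub>R e i)" if "n \<ge> 1" for n
    using c[OF that] that by simp
  then show "block_basis e u" unfolding block_basis_def using F by blast
qed

text \<open>The asymptotic estimate speaks of block bases of the given basis, but it will be applied
  to blocks of a block basis. Uniting the supports over consecutive index sets gives consecutive
  supports again.\<close>

lemma block_basis_trans:
  assumes "block_basis e w" and "block_basis w y"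
  shows "block_basis e y"
proof -
  obtain F where F: "\<And>n. n \<ge> 1 \<Longrightarrow> finite (F n) \<and> F n \<noteq> {} \<and> F n \<subseteq> {1..} \<and>
      set_less (F n) (F (Suc n)) \<and> w n \<in> span (e ` F n) \<and> w n \<noteq> 0"
    using assms(1) unfolding block_basis_iff by blast
  obtain G where G: "\<And>n. n \<ge> 1 \<Longrightarrow> finite (G n) \<and> G n \<noteq> {} \<and> G n \<subseteq> {1..} \<and>
      set_less (G n) (G (Suc n)) \<and> y n \<in> span (w ` G n) \<and> y n \<noteq> 0"
    using assms(2) unfolding block_basis_iff by blast
  define H where "H n = (\<Union>i\<in>G n. F i)" for n
  have fin: "finite (H n) \<and> H n \<noteq> {} \<and> H n \<subseteq> {1..}" if "n \<ge> 1" for n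
    unfolding H_def using G[OF that] F by (fastforce simp: subset_iff)
  have less: "set_less (H n) (H (Suc n))" if "n \<ge> 1" for n
  proof -
    have "a < b" if ab: "a \<in> H n" "b \<in> H (Suc n)" for a b
    proof -
      obtain i j where ij: "i \<in> G n" "j \<in> G (Suc n)" "a \<in> F i" "b \<in> F j"
        using ab by (auto simp: H_def)
      have "i < j"
        using set_less_iff[of "G n" "G (Suc n)"] G[OF \<open>n \<ge> 1\<close>] G[of "Suc n"] ij by auto
      moreover have "1 \<le> i" using G[OF \<open>n \<ge> 1\<close>] ij by auto
      ultimately show ?thesis using set_less_chain[of F i j] F ij by blast
    qed
    then show ?thesis using fin[OF that] fin[of "Suc n"] by (simp add: set_less_iff)
  qed
  have "y n \<in> span (e ` H n)" if "n \<ge> 1" for n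
  proof -
    have "w ` G n \<subseteq> span (e ` H n)"
    proof
      fix z assume "z \<in> w ` G n"
      then obtain i where i: "i \<in> G n" "z = w i" by blast
      then have "z \<in> span (e ` F i)" using F[of i] G[OF that] by auto
      moreover have "span (e ` F i) \<subseteq> span (e ` H n)"
        using i by (intro span_mono) (auto simp: H_def)
      ultimately show "z \<in> span (e ` H n)" by blast
    qed
    then have "span (w ` G n) \<subseteq> span (e ` H n)" by (simp add: span_minimal)
    then show ?thesis using G[OF that] by blast
  qed
  then show ?thesis unfolding block_basis_iff using fin less G by (intro exI[of _ H]) blast
qed

lemma block_basis_normalize:
  assumes "block_basis e y"
  shows "block_basis e (\<lambda>n. y n /\<^sub>R norm (y n))"
  using assms unfolding block_basis_iff by (meson span_scale norm_eq_zero scaleR_eq_0_iff inverse_nonzero_iff_nonzero)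

section \<open>Members of the Schreier families\<close>

lemma schreier_pos: "F \<in> schreier \<xi> \<Longrightarrow> F \<subseteq> {1..}"
proof (induction \<xi> arbitrary: F)
  case (Suc \<xi>)
  then show ?case by fastforce
qed auto

lemma singleton_schreier: "n \<ge> 1 \<Longrightarrow> {n} \<in> schreier \<xi>"
proof (induction \<xi>)
  case (Suc \<xi>)
  then show ?case by (auto intro!: exI[of _ 1] exI[of _ "\<lambda>_. {n}"])
qed auto

text \<open>A set with minimum 1 may consist of only one piece at each level, so
  \<open>{1, 2}\<close> lies in no Schreier family; estimates for two vectors have to use later
  positions.\<close>

lemma pair_schreier: "{2, 3} \<in> schreier (Suc \<xi>)"
proof -
  have 12: "{1..2::nat} = {1, 2}" "{1..<2::nat} = {1}" by auto
  have "{2, 3} = (\<Union>i\<in>{1..2}. {Suc i})" unfolding 12 by auto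
  moreover have "\<forall>i\<in>{1..2}. {Suc i} \<noteq> {} \<and> {Suc i} \<in> schreier \<xi>"
    by (simp add: singleton_schreier)
  ultimately show ?thesis unfolding schreier.simps
    by (intro UnI1 CollectI exI[of _ 2] exI[of _ "\<lambda>i. {Suc i}"]) (simp add: set_less_def)
qed

section \<open>Norm estimates for asymptotic l1 bases\<close>

lemma schauder_basis_nonzero:
  assumes "schauder_basis e" and "k \<ge> 1"
  shows "e k \<noteq> 0"
proof
  assume "e k = 0"
  then have "(\<lambda>i. (if Suc i = k then 1 else 0) *\<^sub>R e (Suc i)) = (\<lambda>i. 0)" by auto
  then have one: "(\<lambda>i. (if Suc i = k then 1 else 0) *\<^sub>R e (Suc i)) sums 0" by simp
  have zero: "(\<lambda>i. 0 *\<^sub>R e (Suc i)) sums 0" by simp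
  have "\<exists>!a::nat \<Rightarrow> real. (\<lambda>i. a i *\<^sub>R e (Suc i)) sums 0"
    using assms(1) unfolding schauder_basis_def by blast
  then obtain b :: "nat \<Rightarrow> real" where b: "\<And>a. (\<lambda>i. a i *\<^sub>R e (Suc i)) sums 0 \<Longrightarrow> a = b"
    by (elim ex1E) blast
  have "(\<lambda>i. if Suc i = k then 1 else 0) = (\<lambda>i. 0::real)"
    using b[OF one] b[OF zero] by simp
  from fun_cong[OF this, of "k - 1"] show False using assms(2) by simp
qed

text \<open>The bound comes from testing the lower estimate on one unit vector, through the
  singleton \<open>{1}\<close>.\<close>

lemma asymptotic_l1_le_1:
  assumes "asymptotic_l1 \<epsilon> \<xi> e" and nz: "\<And>k. k \<ge> 1 \<Longrightarrow> e k \<noteq> 0"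
  shows "\<epsilon> \<le> 1"
proof -
  define x where "x k = e k /\<^sub>R norm (e k)" for k
  have "block_basis e x" unfolding block_basis_iff
    by (rule exI[of _ "\<lambda>n. {n}"]) (auto simp: x_def set_less_def nz intro: span_scale[OF span_base])
  moreover have "normalized x" by (simp add: normalized_def x_def nz)
  ultimately have "l1_spreading_model \<epsilon> \<xi> x" using assms(1) by (simp add: asymptotic_l1_def)
  then have "\<forall>a::nat \<Rightarrow> real. \<epsilon> * (\<Sum>i\<in>{1}. \<bar>a i\<bar>) \<le> norm (\<Sum>i\<in>{1}. a i *\<^sub>R x i)"
    unfolding l1_spreading_model_def using singleton_schreier[of 1 \<xi>] by blast
  from spec[OF this, of "\<lambda>_. 1"]
  show ?thesis using \<open>normalized x\<close> by (simp add: normalized_def)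
qed

text \<open>This estimate plays the role of the basis constant. The support of \<open>A\<close> starts at \<open>2\<close> so
  that \<open>A\<close> and \<open>B\<close> can be placed at positions \<open>2\<close> and \<open>3\<close> of a block basis.\<close>

lemma asymptotic_l1_two_blocks:
  assumes as: "asymptotic_l1 \<epsilon> \<xi> e" and "\<epsilon> > 0" and "\<xi> \<ge> 1" and nz: "\<And>k. k \<ge> 1 \<Longrightarrow> e k \<noteq> 0"
    and fin: "finite P" "finite Q" and P: "P \<subseteq> {2..}" and Q: "Q \<subseteq> {2..}"
    and PQ: "\<And>p q. p \<in> P \<Longrightarrow> q \<in> Q \<Longrightarrow> p < q"
    and A: "A \<in> span (e ` P)" and B: "B \<in> span (e ` Q)"
  shows "\<epsilon> * (norm A + norm B) \<le> norm (A + B)"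
proof (cases "A = 0 \<or> B = 0")
  case True
  then show ?thesis using asymptotic_l1_le_1[OF as nz] \<open>\<epsilon> > 0\<close>
    by (auto simp: mult_left_le_one_le)
next
  case False
  then have ne: "P \<noteq> {}" "Q \<noteq> {}" using A B by auto
  \<comment> \<open>Position 1 is filled by \<open>e 1\<close> and the positions from 4 on by basis
    vectors beyond \<open>Q\<close>; they only complete \<open>A\<close> and \<open>B\<close> to an
    infinite block basis.\<close>
  define F where "F n = (if n = 1 then {1} else if n = 2 then P else if n = 3 then Q else {Max Q + n})"
    for n :: nat
  define z where "z n = (if n = 1 then e 1 else if n = 2 then A else if n = 3 then B else e (Max Q + n))"
    for n :: nat
  define x where "x = (\<lambda>n. z n /\<^sub>R norm (z n))"
  have z: "block_basis e z" unfolding block_basis_iff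
  proof (intro exI[of _ F] allI impI)
    fix n :: nat assume "n \<ge> 1"
    then consider "n = 1" | "n = 2" | "n = 3" | "n \<ge> 4" by linarith
    then show "finite (F n) \<and> F n \<noteq> {} \<and> F n \<subseteq> {1..} \<and> set_less (F n) (F (Suc n)) \<and>
        z n \<in> span (e ` F n) \<and> z n \<noteq> 0"
    proof cases
      case 1
      have "Suc 0 < Min P" using fin ne P by (auto simp: Min_gr_iff)
      then show ?thesis using 1 nz by (auto simp: F_def z_def set_less_def span_base)
    next
      case 2
      have "set_less P Q" using fin ne PQ by (simp add: set_less_iff)
      then show ?thesis using 2 False A fin ne P by (auto simp: F_def z_def)
    next
      case 3
      then show ?thesis using False B fin ne Q by (auto simp: F_def z_def set_less_def)
    next
      case 4
      then show ?thesis using nz by (auto simp: F_def z_def set_less_def span_base)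
    qed
  qed
  then have "z n \<noteq> 0" if "n \<ge> 1" for n using that unfolding block_basis_def by blast
  then have "normalized x" by (simp add: normalized_def x_def)
  moreover have "block_basis e x" unfolding x_def by (rule block_basis_normalize[OF z])
  ultimately have l1: "l1_spreading_model \<epsilon> \<xi> x" using as by (simp add: asymptotic_l1_def)
  have S: "{2, 3} \<in> schreier \<xi>" using pair_schreier[of "\<xi> - 1"] \<open>\<xi> \<ge> 1\<close> by simp
  have "\<forall>a::nat \<Rightarrow> real. \<epsilon> * (\<Sum>i\<in>{2,3}. \<bar>a i\<bar>) \<le> norm (\<Sum>i\<in>{2,3}. a i *\<^sub>R x i)"
    using l1 S unfolding l1_spreading_model_def by blast
  \<comment> \<open>The coefficients \<open>norm (z i)\<close> undo the normalization, so the
    combination is \<open>A + B\<close>.\<close>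
  from spec[OF this, of "\<lambda>i. norm (z i)"] show ?thesis using False by (simp add: z_def x_def)
qed

text \<open>Cutting the sum just after \<open>k\<close>, and what remains just before
  \<open>k\<close>, isolates one term. Each cut costs a factor \<epsilon> by
  \<open>asymptotic_l1_two_blocks\<close>, whence the square.\<close>

lemma asymptotic_l1_coefficient_bound:
  assumes as: "asymptotic_l1 \<epsilon> \<xi> e" and "\<epsilon> > 0" and "\<xi> \<ge> 1" and nz: "\<And>k. k \<ge> 1 \<Longrightarrow> e k \<noteq> 0"
    and F: "\<And>n. n \<ge> 1 \<Longrightarrow> finite (F n) \<and> F n \<noteq> {} \<and> F n \<subseteq> {2..} \<and> set_less (F n) (F (Suc n)) \<and>
        u n \<in> span (e ` F n)"
    and G: "finite G" "G \<subseteq> {1..}" "k \<in> G"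
  shows "\<epsilon>\<^sup>2 * (\<bar>b k\<bar> * norm (u k)) \<le> norm (\<Sum>i\<in>G. b i *\<^sub>R u i)"
proof -
  define L where "L = {i\<in>G. i < k}"
  define R where "R = {i\<in>G. k < i}"
  have G_eq: "G = insert k (L \<union> R)" and disj: "k \<notin> L \<union> R" "L \<inter> R = {}"
    using G(3) by (auto simp: L_def R_def)
  have fin: "finite L" "finite R" using G by (auto simp: L_def R_def)
  have fin': "finite (\<Union>i\<in>K. F i)" "(\<Union>i\<in>K. F i) \<subseteq> {2..}" if "K \<subseteq> G" for K
  proof -
    have "finite K" using that G finite_subset by blast
    then show "finite (\<Union>i\<in>K. F i)" using F that G by (meson finite_UN atLeast_iff subsetD)
    show "(\<Union>i\<in>K. F i) \<subseteq> {2..}" using F that G by (meson UN_least atLeast_iff subsetD)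
  qed
  define A where "A K = (\<Sum>i\<in>K. b i *\<^sub>R u i)" for K
  have A: "A K \<in> span (e ` (\<Union>i\<in>K. F i))" if "K \<subseteq> G" for K
    unfolding A_def
  proof (intro span_sum span_scale)
    fix i assume i: "i \<in> K"
    then have "u i \<in> span (e ` F i)" using F that G by (meson atLeast_iff subsetD)
    moreover have "span (e ` F i) \<subseteq> span (e ` (\<Union>i\<in>K. F i))"
      using i by (intro span_mono) auto
    ultimately show "u i \<in> span (e ` (\<Union>i\<in>K. F i))" by blast
  qed
  have two: "\<epsilon> * (norm (A K) + norm (A K')) \<le> norm (A K + A K')"
    if K: "K \<subseteq> G" "K' \<subseteq> G" and less: "\<And>i j. i \<in> K \<Longrightarrow> j \<in> K' \<Longrightarrow> i < j" for K K'
  proof (rule asymptotic_l1_two_blocks[where P = "\<Union>i\<in>K. F i" and Q = "\<Union>i\<in>K'. F i",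
        OF as \<open>\<epsilon> > 0\<close> \<open>\<xi> \<ge> 1\<close> nz])
    show "finite (\<Union>i\<in>K. F i)" "finite (\<Union>i\<in>K'. F i)"
      "(\<Union>i\<in>K. F i) \<subseteq> {2..}" "(\<Union>i\<in>K'. F i) \<subseteq> {2..}"
      "A K \<in> span (e ` (\<Union>i\<in>K. F i))" "A K' \<in> span (e ` (\<Union>i\<in>K'. F i))"
      using fin' A K by blast+
  next
    fix p q assume "p \<in> (\<Union>i\<in>K. F i)" "q \<in> (\<Union>i\<in>K'. F i)"
    then obtain i j where ij: "i \<in> K" "j \<in> K'" "p \<in> F i" "q \<in> F j" by blast
    then have "1 \<le> i" "i < j" using K G less by auto
    then show "p < q" using set_less_chain[of F i j] F ij by blast
  qed auto
  have sub: "L \<subseteq> G" "R \<subseteq> G" "{k} \<subseteq> G" "insert k L \<subseteq> G" using G_eq by auto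
  have "\<epsilon> * norm (A {k}) \<le> \<epsilon> * (norm (A L) + norm (A {k}))"
    using \<open>\<epsilon> > 0\<close> by simp
  also have "\<dots> \<le> norm (A L + A {k})" by (rule two[OF sub(1) sub(3)]) (auto simp: L_def)
  also have "A L + A {k} = A (insert k L)" using fin disj by (simp add: A_def)
  finally have "\<epsilon> * (\<epsilon> * norm (A {k})) \<le> \<epsilon> * norm (A (insert k L))"
    using \<open>\<epsilon> > 0\<close> by simp
  also have "\<dots> \<le> \<epsilon> * (norm (A (insert k L)) + norm (A R))"
    using \<open>\<epsilon> > 0\<close> by simp
  also have "\<dots> \<le> norm (A (insert k L) + A R)"
    by (rule two[OF sub(4) sub(2)]) (auto simp: L_def R_def)
  also have "A (insert k L) + A R = A G"
    unfolding G_eq A_def using fin disj by (simp add: sum.union_disjoint)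
  finally show ?thesis by (simp add: A_def power2_eq_square mult.assoc)
qed

section \<open>Small perturbations of block sequences\<close>

lemma sum_half_powers_le_1:
  assumes "finite G" "G \<subseteq> {1..}"
  shows "(\<Sum>i\<in>G. (1/2::real) ^ i) \<le> 1"
proof -
  \<comment> \<open>The shift by one matches \<open>power_half_series\<close>, whose terms have
    exponent \<open>Suc i\<close>.\<close>
  have "(\<Sum>i\<in>G. (1/2::real) ^ i) = (\<Sum>i\<in>(\<lambda>i. i - 1) ` G. (1/2) ^ Suc i)"
  proof (subst sum.reindex)
    show "inj_on (\<lambda>i. i - 1) G"
      using assms(2) by (intro inj_onI) (metis Suc_pred' atLeast_iff less_eq_Suc_le One_nat_def subsetD)
    show "(\<Sum>i\<in>G. (1/2::real) ^ i) = sum ((\<lambda>i. (1/2) ^ Suc i) \<circ> (\<lambda>i. i - 1)) G"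
    proof (rule sum.cong[OF refl])
      fix i assume "i \<in> G"
      then have "Suc (i - 1) = i" using assms(2) by auto
      then show "(1/2::real) ^ i = ((\<lambda>i. (1/2) ^ Suc i) \<circ> (\<lambda>i. i - 1)) i" by (simp only: o_apply)
    qed
  qed
  also have "\<dots> \<le> 1"
    using sum_le_suminf[OF sums_summable[OF power_half_series], of "(\<lambda>i. i - 1) ` G"]
      sums_unique[OF power_half_series] assms(1) by simp
  finally show ?thesis .
qed

text \<open>If \<open>N\<close> is the norm of the sum of the \<open>b i *\<^sub>R u i\<close>, the
  coefficient bound gives \<open>\<bar>b i\<bar> \<le> N / (\<epsilon>\<^sup>2 * c)\<close>. With
  the bound on \<eta>, the error at \<open>i\<close> is at most \<open>N / 2\<close> times
  \<open>(1/2) ^ i\<close>, and these weights add up to at most 1.\<close>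

lemma block_perturbation:
  assumes as: "asymptotic_l1 \<epsilon> \<xi> e" and "\<epsilon> > 0" and "\<xi> \<ge> 1" and nz: "\<And>k. k \<ge> 1 \<Longrightarrow> e k \<noteq> 0"
    and F: "\<And>n. n \<ge> 1 \<Longrightarrow> finite (F n) \<and> F n \<noteq> {} \<and> F n \<subseteq> {2..} \<and> set_less (F n) (F (Suc n)) \<and>
        u n \<in> span (e ` F n)"
    and c: "c > 0" "\<And>n. n \<ge> 1 \<Longrightarrow> norm (u n) \<ge> c"
    and close: "\<And>n. n \<ge> 1 \<Longrightarrow> norm (u n - v n) \<le> \<eta> * (1/2) ^ n" and \<eta>: "\<eta> \<le> \<epsilon>\<^sup>2 * c / 2"
    and G: "finite G" "G \<subseteq> {1..}"
  shows "norm ((\<Sum>i\<in>G. b i *\<^sub>R u i) - (\<Sum>i\<in>G. b i *\<^sub>R v i)) \<le> norm (\<Sum>i\<in>G. b i *\<^sub>R u i) / 2"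
proof -
  define N where "N = norm (\<Sum>i\<in>G. b i *\<^sub>R u i)"
  have term_le: "\<bar>b i\<bar> * norm (u i - v i) \<le> (N / 2) * (1/2) ^ i" if i: "i \<in> G" for i
  proof -
    have i1: "i \<ge> 1" using i G by auto
    have "\<epsilon>\<^sup>2 * (\<bar>b i\<bar> * c) \<le> \<epsilon>\<^sup>2 * (\<bar>b i\<bar> * norm (u i))"
      using c(2)[OF i1] \<open>\<epsilon> > 0\<close> by (simp add: mult_left_mono)
    also have "\<dots> \<le> N"
      unfolding N_def
      by (rule asymptotic_l1_coefficient_bound[where b = b and u = u and F = F and k = i and e = e, OF as \<open>\<epsilon> > 0\<close> \<open>\<xi> \<ge> 1\<close> nz F G i])
    finally have b: "\<epsilon>\<^sup>2 * (\<bar>b i\<bar> * c) \<le> N" .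
    have "\<bar>b i\<bar> * norm (u i - v i) \<le> \<bar>b i\<bar> * (\<eta> * (1/2) ^ i)"
      using close[OF i1] by (simp add: mult_left_mono)
    also have "\<dots> \<le> \<bar>b i\<bar> * ((\<epsilon>\<^sup>2 * c / 2) * (1/2) ^ i)"
      using \<eta> by (intro mult_left_mono mult_right_mono) auto
    also have "\<dots> = (\<epsilon>\<^sup>2 * (\<bar>b i\<bar> * c) / 2) * (1/2) ^ i" by simp
    also have "\<dots> \<le> (N / 2) * (1/2) ^ i"
      using b by (intro mult_right_mono divide_right_mono) auto
    finally show ?thesis .
  qed
  have "norm ((\<Sum>i\<in>G. b i *\<^sub>R u i) - (\<Sum>i\<in>G. b i *\<^sub>R v i)) = norm (\<Sum>i\<in>G. b i *\<^sub>R (u i - v i))"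
    by (simp add: sum_subtractf scaleR_diff_right)
  also have "\<dots> \<le> (\<Sum>i\<in>G. \<bar>b i\<bar> * norm (u i - v i))"
    by (rule sum_norm_le) simp
  also have "\<dots> \<le> (\<Sum>i\<in>G. (N / 2) * (1/2) ^ i)" by (rule sum_mono) (rule term_le)
  also have "\<dots> = (N / 2) * (\<Sum>i\<in>G. (1/2) ^ i)" by (simp add: sum_distrib_left)
  also have "\<dots> \<le> (N / 2) * 1"
    using sum_half_powers_le_1[OF G] by (intro mult_left_mono) (auto simp: N_def)
  finally show ?thesis by (simp add: N_def)
qed

section \<open>Common kernels of finitely many functionals\<close>

text \<open>A kernel has codimension at most one: if a finite \<open>B\<close> spanned it, adding
  one vector \<open>w\<close> with \<open>f w \<noteq> 0\<close> would give a finite spanning set of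
  \<open>V\<close>.\<close>

lemma infinite_dim_kernel:
  fixes V :: "'a::real_vector set" and f :: "'a \<Rightarrow> real"
  assumes V: "subspace V" "\<not> (\<exists>B. finite B \<and> span B = V)"
    and add: "\<And>x y. x \<in> V \<Longrightarrow> y \<in> V \<Longrightarrow> f (x + y) = f x + f y"
    and scale: "\<And>c x. x \<in> V \<Longrightarrow> f (c *\<^sub>R x) = c * f x"
  shows "subspace {x\<in>V. f x = 0}" and "\<not> (\<exists>B. finite B \<and> span B = {x\<in>V. f x = 0})"
proof -
  have "f 0 = 0" using scale[of 0 0] V(1) by (simp add: subspace_0)
  then show "subspace {x\<in>V. f x = 0}"
    using V(1) by (auto simp: subspace_def add scale)
  show "\<not> (\<exists>B. finite B \<and> span B = {x\<in>V. f x = 0})"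
  proof
    assume "\<exists>B. finite B \<and> span B = {x\<in>V. f x = 0}"
    then obtain B where B: "finite B" "span B = {x\<in>V. f x = 0}" by blast
    show False
    proof (cases "\<forall>x\<in>V. f x = 0")
      case True
      then have "span B = V" using B by auto
      then show False using V B by blast
    next
      case False
      then obtain w where w: "w \<in> V" "f w \<noteq> 0" by blast
      have "V \<subseteq> span (insert w B)"
      proof
        fix x assume x: "x \<in> V"
        have "x - (f x / f w) *\<^sub>R w \<in> V" using V(1) x w by (simp add: subspace_diff subspace_scale)
        moreover have "f (x - (f x / f w) *\<^sub>R w) = 0"
          using add[of x "(- (f x / f w)) *\<^sub>R w"] scale[of w "- (f x / f w)"] x w V(1)
          by (simp add: subspace_scale subspace_neg)
        ultimately have "x - (f x / f w) *\<^sub>R w \<in> span B" using B by blast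
        then show "x \<in> span (insert w B)" unfolding span_insert by blast
      qed
      moreover have "span (insert w B) \<subseteq> V"
        using V(1) w B span_superset[of B] by (intro span_minimal) auto
      ultimately show False using V(2) B(1) by (metis finite_insert subset_antisym)
    qed
  qed
qed

lemma infinite_dim_common_kernel:
  fixes V :: "'a::real_vector set" and f :: "nat \<Rightarrow> 'a \<Rightarrow> real"
  assumes V: "subspace V" "\<not> (\<exists>B. finite B \<and> span B = V)"
    and add: "\<And>k x y. x \<in> V \<Longrightarrow> y \<in> V \<Longrightarrow> f k (x + y) = f k x + f k y"
    and scale: "\<And>k c x. x \<in> V \<Longrightarrow> f k (c *\<^sub>R x) = c * f k x"
  shows "subspace {x\<in>V. \<forall>k<m. f k x = 0} \<and> \<not> (\<exists>B. finite B \<and> span B = {x\<in>V. \<forall>k<m. f k x = 0})"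
proof (induction m)
  case 0
  then show ?case using V by simp
next
  case (Suc m)
  have "{x\<in>V. \<forall>k<Suc m. f k x = 0} = {x\<in>{x\<in>V. \<forall>k<m. f k x = 0}. f m x = 0}"
    by (auto simp: less_Suc_eq)
  then show ?case
    using infinite_dim_kernel[of "{x\<in>V. \<forall>k<m. f k x = 0}" "f m"] Suc add scale by simp
qed

section \<open>Coordinates with respect to a Schauder basis\<close>

definition coord :: "(nat \<Rightarrow> 'a::banach) \<Rightarrow> 'a \<Rightarrow> nat \<Rightarrow> real" where
  "coord e x = (THE a. (\<lambda>k. a k *\<^sub>R e (Suc k)) sums x)"

lemma coord_sums:
  assumes "schauder_basis e"
  shows "(\<lambda>k. coord e x k *\<^sub>R e (Suc k)) sums x"
proof -
  have "\<exists>!a. (\<lambda>k. a k *\<^sub>R e (Suc k)) sums x" using assms unfolding schauder_basis_def by blast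
  then show ?thesis unfolding coord_def by (rule theI')
qed

lemma coord_eqI:
  assumes "schauder_basis e" and "(\<lambda>k. a k *\<^sub>R e (Suc k)) sums x"
  shows "coord e x = a"
  using assms coord_sums[OF assms(1), of x] unfolding schauder_basis_def by blast

lemma coord_add:
  assumes "schauder_basis e"
  shows "coord e (x + y) k = coord e x k + coord e y k"
proof -
  have "coord e (x + y) = (\<lambda>k. coord e x k + coord e y k)"
    using sums_add[OF coord_sums[OF assms, of x] coord_sums[OF assms, of y]]
    by (intro coord_eqI[OF assms]) (simp add: scaleR_add_left)
  then show ?thesis by simp
qed

lemma coord_scale:
  assumes "schauder_basis e"
  shows "coord e (c *\<^sub>R x) k = c * coord e x k"
proof -
  have "coord e (c *\<^sub>R x) = (\<lambda>k. c * coord e x k)"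
    using sums_scaleR_right[OF coord_sums[OF assms, of x], of c]
    by (intro coord_eqI[OF assms]) simp
  then show ?thesis by simp
qed

lemma schauder_tail_approx:
  assumes "schauder_basis e" and zero: "\<And>k. k < m \<Longrightarrow> coord e x k = 0" and "\<eta> > 0"
  shows "\<exists>N. \<forall>q\<ge>N. \<exists>u\<in>span (e ` {m<..q}). norm (x - u) < \<eta>"
proof -
  obtain N where N: "\<And>q. q \<ge> N \<Longrightarrow> norm ((\<Sum>k<q. coord e x k *\<^sub>R e (Suc k)) - x) < \<eta>"
    using coord_sums[OF assms(1), of x] \<open>\<eta> > 0\<close> unfolding sums_def LIMSEQ_iff by blast
  show ?thesis
  proof (intro exI[of _ N] allI impI bexI)
    fix q assume q: "q \<ge> N"
    show "norm (x - (\<Sum>k<q. coord e x k *\<^sub>R e (Suc k))) < \<eta>"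
      using N[OF q] by (simp add: norm_minus_commute)
    show "(\<Sum>k<q. coord e x k *\<^sub>R e (Suc k)) \<in> span (e ` {m<..q})"
    proof (rule span_sum)
      fix k assume k: "k \<in> {..<q}"
      show "coord e x k *\<^sub>R e (Suc k) \<in> span (e ` {m<..q})"
        by (cases "k < m") (use k zero in \<open>auto intro!: span_zero span_scale[OF span_base]\<close>)
    qed
  qed
qed

section \<open>Simultaneous block sequences in both spaces\<close>

text \<open>This is one step of a gliding hump argument. Asking the first \<open>m\<close>
  coordinates of both \<open>v\<close> and \<open>T v\<close> to vanish imposes finitely many linear
  conditions, which some unit vector of an infinite dimensional space satisfies.\<close>

lemma common_block_step:
  fixes e :: "nat \<Rightarrow> 'a::banach" and e' :: "nat \<Rightarrow> 'b::banach"
    and V :: "'a set" and T :: "'a \<Rightarrow> 'b"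
  assumes e: "schauder_basis e" "schauder_basis e'"
    and V: "subspace V" "\<not> (\<exists>B. finite B \<and> span B = V)"
    and add: "\<And>x y. x \<in> V \<Longrightarrow> y \<in> V \<Longrightarrow> T (x + y) = T x + T y"
    and scale: "\<And>c x. x \<in> V \<Longrightarrow> T (c *\<^sub>R x) = c *\<^sub>R T x"
    and "\<eta> > 0"
  shows "\<exists>q v u w. m < q \<and> v \<in> V \<and> norm v = 1 \<and> u \<in> span (e ` {m<..q}) \<and> w \<in> span (e' ` {m<..q})
      \<and> norm (v - u) < \<eta> \<and> norm (T v - w) < \<eta>"
proof -
  \<comment> \<open>Even indices carry the coordinates of \<open>x\<close> and odd ones those of
    \<open>T x\<close>, so \<open>k < 2*m\<close> covers the first \<open>m\<close> of each.\<close>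
  define f where "f k x = (if even k then coord e x (k div 2) else coord e' (T x) (k div 2))" for k x
  have "subspace {x\<in>V. \<forall>k<2*m. f k x = 0} \<and> \<not> (\<exists>B. finite B \<and> span B = {x\<in>V. \<forall>k<2*m. f k x = 0})"
    by (rule infinite_dim_common_kernel[OF V])
      (simp_all add: f_def coord_add[OF e(1)] coord_add[OF e(2)] coord_scale[OF e(1)]
        coord_scale[OF e(2)] add scale)
  \<comment> \<open>Since \<open>{0} = span {}\<close>, a space without a finite spanning set
    contains a nonzero vector.\<close>
  then have sub: "subspace {x\<in>V. \<forall>k<2*m. f k x = 0}" and "{x\<in>V. \<forall>k<2*m. f k x = 0} \<noteq> {0}"
    by (simp, metis span_empty finite.emptyI)
  then obtain x where x: "x \<in> {x\<in>V. \<forall>k<2*m. f k x = 0}" "x \<noteq> 0"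
    using subspace_0 by blast
  define v where "v = x /\<^sub>R norm x"
  have v: "v \<in> {x\<in>V. \<forall>k<2*m. f k x = 0}" "norm v = 1"
    using x subspace_scale[OF sub x(1)] by (simp_all add: v_def)
  have "coord e v k = 0" "coord e' (T v) k = 0" if "k < m" for k
    using v(1) that f_def[of "2*k" v] f_def[of "2*k+1" v] by auto
  then obtain N N' where
    N: "\<And>q. q \<ge> N \<Longrightarrow> \<exists>u\<in>span (e ` {m<..q}). norm (v - u) < \<eta>" and
    N': "\<And>q. q \<ge> N' \<Longrightarrow> \<exists>u\<in>span (e' ` {m<..q}). norm (T v - u) < \<eta>"
    using schauder_tail_approx[OF e(1) _ \<open>\<eta> > 0\<close>, of m v]
      schauder_tail_approx[OF e(2) _ \<open>\<eta> > 0\<close>, of m "T v"] by metis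
  \<comment> \<open>The entry \<open>Suc m\<close> keeps the interval \<open>{m<..q}\<close>
    nonempty.\<close>
  define q where "q = max (Suc m) (max N N')"
  have "m < q" "q \<ge> N" "q \<ge> N'" by (simp_all add: q_def)
  then show ?thesis using N[of q] N'[of q] v by blast
qed

text \<open>The supports \<open>F n\<close> are shared by the two spaces, so one sequence of
  interval endpoints drives the recursion. The errors decrease geometrically, as
  \<open>block_perturbation\<close> requires.\<close>

lemma common_block_sequences:
  fixes e :: "nat \<Rightarrow> 'a::banach" and e' :: "nat \<Rightarrow> 'b::banach"
    and V :: "'a set" and T :: "'a \<Rightarrow> 'b"
  assumes e: "schauder_basis e" "schauder_basis e'"
    and V: "subspace V" "\<not> (\<exists>B. finite B \<and> span B = V)"
    and add: "\<And>x y. x \<in> V \<Longrightarrow> y \<in> V \<Longrightarrow> T (x + y) = T x + T y"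
    and scale: "\<And>c x. x \<in> V \<Longrightarrow> T (c *\<^sub>R x) = c *\<^sub>R T x"
    and "\<eta> > 0"
  obtains F v u w where
    "\<And>n. n \<ge> 1 \<Longrightarrow> finite (F n) \<and> F n \<noteq> {} \<and> F n \<subseteq> {2..} \<and> set_less (F n) (F (Suc n)) \<and>
       u n \<in> span (e ` F n)"
    "\<And>n. n \<ge> 1 \<Longrightarrow> w n \<in> span (e' ` F n)"
    "\<And>n. n \<ge> 1 \<Longrightarrow> v n \<in> V \<and> norm (v n) = 1"
    "\<And>n. n \<ge> 1 \<Longrightarrow> norm (u n - v n) \<le> \<eta> * (1/2) ^ n"
    "\<And>n. n \<ge> 1 \<Longrightarrow> norm (w n - T (v n)) \<le> \<eta> * (1/2) ^ n"
proof -
  \<comment> \<open>A state holds the right end of the current interval and the three vectors chosen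
    with it; the vectors of the initial state are placeholders.\<close>
  define Q where "Q n s t \<longleftrightarrow> (case (s, t) of ((m, _, _, _), (q, v, u, w)) \<Rightarrow>
      m < q \<and> v \<in> V \<and> norm v = 1 \<and> u \<in> span (e ` {m<..q}) \<and> w \<in> span (e' ` {m<..q})
      \<and> norm (v - u) < \<eta> * (1/2) ^ Suc n \<and> norm (T v - w) < \<eta> * (1/2) ^ Suc n)"
    for n and s t :: "nat \<times> 'a \<times> 'a \<times> 'b"
  have "\<exists>g. \<forall>n. 1 \<le> fst (g n) \<and> Q n (g n) (g (Suc n))"
  proof (rule dependent_nat_choice)
    \<comment> \<open>Starting at the endpoint 1 puts all supports into \<open>{2..}\<close>, where
      \<open>asymptotic_l1_two_blocks\<close> applies.\<close>
    show "\<exists>s :: nat \<times> 'a \<times> 'a \<times> 'b. 1 \<le> fst s" by (rule exI[of _ "(1, 0, 0, 0)"]) simp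
    fix s :: "nat \<times> 'a \<times> 'a \<times> 'b" and n assume s: "1 \<le> fst s"
    have "\<eta> * (1/2) ^ Suc n > 0" using \<open>\<eta> > 0\<close> by simp
    from common_block_step[where m = "fst s" and T = T, OF e V add scale this]
    obtain q v u w where "fst s < q \<and> v \<in> V \<and> norm v = 1 \<and> u \<in> span (e ` {fst s<..q}) \<and>
        w \<in> span (e' ` {fst s<..q}) \<and> norm (v - u) < \<eta> * (1/2) ^ Suc n \<and>
        norm (T v - w) < \<eta> * (1/2) ^ Suc n" by auto
    then show "\<exists>t. 1 \<le> fst t \<and> Q n s t" using s
      by (intro exI[of _ "(q, v, u, w)"]) (simp add: Q_def split_beta)
  qed
  then obtain g where g: "\<And>n. 1 \<le> fst (g n)" "\<And>n. Q n (g n) (g (Suc n))" by blast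
  define m where "m n = fst (g n)" for n
  define v where "v n = fst (snd (g n))" for n
  define u where "u n = fst (snd (snd (g n)))" for n
  define w where "w n = snd (snd (snd (g n)))" for n
  define F where "F n = {m (n - 1)<..m n}" for n
  have Suc: "m n < m (Suc n) \<and> v (Suc n) \<in> V \<and> norm (v (Suc n)) = 1 \<and> u (Suc n) \<in> span (e ` F (Suc n))
      \<and> w (Suc n) \<in> span (e' ` F (Suc n)) \<and> norm (v (Suc n) - u (Suc n)) < \<eta> * (1/2) ^ Suc n
      \<and> norm (T (v (Suc n)) - w (Suc n)) < \<eta> * (1/2) ^ Suc n" for n
    using g(2)[of n] unfolding Q_def m_def v_def u_def w_def F_def
    by (auto split: prod.splits)
  have m1: "1 \<le> m n" for n using g(1) by (simp add: m_def)
  have F: "finite (F (Suc n)) \<and> F (Suc n) \<noteq> {} \<and> F (Suc n) \<subseteq> {2..} \<and> set_less (F (Suc n)) (F (Suc (Suc n)))" for n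
  proof -
    have ne: "F (Suc n) \<noteq> {}" "F (Suc (Suc n)) \<noteq> {}" using Suc[of n] Suc[of "Suc n"] by (simp_all add: F_def)
    then have "set_less (F (Suc n)) (F (Suc (Suc n)))"
      by (subst set_less_iff) (auto simp: F_def)
    then show ?thesis using ne m1[of n] by (auto simp: F_def)
  qed
  show thesis
  proof (rule that[of F u w v])
    fix n :: nat assume "n \<ge> 1"
    then obtain k where k: "n = Suc k" by (cases n) auto
    show "finite (F n) \<and> F n \<noteq> {} \<and> F n \<subseteq> {2..} \<and> set_less (F n) (F (Suc n)) \<and> u n \<in> span (e ` F n)"
      using F[of k] Suc[of k] k by simp
    show "w n \<in> span (e' ` F n)" "v n \<in> V \<and> norm (v n) = 1"
      using Suc[of k] k by auto
    show "norm (u n - v n) \<le> \<eta> * (1/2) ^ n" "norm (w n - T (v n)) \<le> \<eta> * (1/2) ^ n"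
      unfolding k using Suc[of k] by (simp_all only: norm_minus_commute less_imp_le)
  qed
qed

section \<open>Equivalence of the two block bases\<close>

text \<open>Continuity at 0 sends a small ball into the unit ball, and homogeneity turns this into a
  norm bound. For the lower bound the same is done with \<open>S\<close>, where
  \<open>S (T x) = x\<close> supplies homogeneity.\<close>

lemma isomorphism_bounds:
  fixes V :: "'a::real_normed_vector set" and T :: "'a \<Rightarrow> 'b::real_normed_vector"
  assumes V: "subspace V"
    and add: "\<And>x y. x \<in> V \<Longrightarrow> y \<in> V \<Longrightarrow> T (x + y) = T x + T y"
    and scale: "\<And>c x. x \<in> V \<Longrightarrow> T (c *\<^sub>R x) = c *\<^sub>R T x"
    and hom: "homeomorphism V W T S"
  obtains M where "M \<ge> 1" "\<And>x. x \<in> V \<Longrightarrow> norm (T x) \<le> M * norm x" "\<And>x. x \<in> V \<Longrightarrow> norm x \<le> M * norm (T x)"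
proof -
  have V0: "0 \<in> V" using V by (rule subspace_0)
  have T0: "T 0 = 0" using scale[OF V0, of 0] by simp
  have ST: "S (T x) = x" if "x \<in> V" for x using hom that by (simp add: homeomorphism_def)
  have TV: "T x \<in> W" if "x \<in> V" for x using hom that by (auto simp: homeomorphism_def)
  have S0: "S 0 = 0" using ST[OF V0] T0 by simp
  have W0: "0 \<in> W" using TV[OF V0] T0 by simp
  have "continuous_on V T" "continuous_on W S" using hom by (simp_all add: homeomorphism_def)
  then obtain r s where r: "r > 0" "\<And>x. x \<in> V \<Longrightarrow> norm x < r \<Longrightarrow> norm (T x) < 1"
    and s: "s > 0" "\<And>y. y \<in> W \<Longrightarrow> norm y < s \<Longrightarrow> norm (S y) < 1"
    using V0 W0 T0 S0 unfolding continuous_on_iff dist_norm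
    by (metis diff_zero zero_less_one)
  have upper: "norm (T x) \<le> (2 / r) * norm x" if x: "x \<in> V" for x
  proof (cases "x = 0")
    case False
    define c where "c = r / (2 * norm x)"
    have c: "c > 0" "norm (c *\<^sub>R x) < r" using r(1) False by (simp_all add: c_def)
    have "norm (T (c *\<^sub>R x)) < 1" using r(2) c(2) V x by (simp add: subspace_scale)
    then have "c * norm (T x) < 1" using c(1) x by (simp add: scale)
    then show ?thesis using r(1) False by (simp add: c_def field_simps)
  qed (simp add: T0)
  have lower: "norm x \<le> (2 / s) * norm (T x)" if x: "x \<in> V" for x
  proof (cases "x = 0")
    case False
    then have Tx: "T x \<noteq> 0" using ST[OF x] S0 by auto
    define c where "c = s / (2 * norm (T x))"
    have c: "c > 0" "norm (T (c *\<^sub>R x)) < s" using s(1) Tx x by (simp_all add: c_def scale)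
    have "norm (S (T (c *\<^sub>R x))) < 1" using s(2) c(2) V x TV by (simp add: subspace_scale)
    then have "c * norm x < 1" using c(1) x V ST by (simp add: subspace_scale)
    then show ?thesis using s(1) Tx by (simp add: c_def field_simps)
  qed (use s(1) in simp)
  define M where "M = max 1 (max (2 / r) (2 / s))"
  show thesis
  proof (rule that[of M])
    show "M \<ge> 1" by (simp add: M_def)
    fix x assume x: "x \<in> V"
    have M: "2 / r \<le> M" "2 / s \<le> M" by (simp_all add: M_def)
    show "norm (T x) \<le> M * norm x"
      using upper[OF x] mult_right_mono[OF M(1) norm_ge_zero[of x]] by linarith
    show "norm x \<le> M * norm (T x)"
      using lower[OF x] mult_right_mono[OF M(2) norm_ge_zero[of "T x"]] by linarith
  qed
qed

text \<open>The span of the pairs \<open>(u k, w k)\<close> is the graph of the linear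
  correspondence between the two block bases. The two inequalities on it make the correspondence
  single valued and bounded in both directions without naming a map.\<close>

lemma equivalent_block_bases:
  fixes e :: "nat \<Rightarrow> 'a::banach" and e' :: "nat \<Rightarrow> 'b::banach"
    and V :: "'a set" and W :: "'b set"
  assumes e: "schauder_basis e" "schauder_basis e'"
    and as: "asymptotic_l1 \<epsilon> \<xi> e" "asymptotic_l1 \<epsilon> \<xi>' e'" and pos: "\<epsilon> > 0" "\<xi> \<ge> 1" "\<xi>' \<ge> 1"
    and V: "banach_subspace V" and iso: "isomorphic_subspaces V W"
  obtains u w C where "block_basis e u" "block_basis e' w" "C > 0"
    "\<And>x y. (x, y) \<in> span ((\<lambda>k. (u k, w k)) ` {1..}) \<Longrightarrow> norm x \<le> C * norm y \<and> norm y \<le> C * norm x"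
proof -
  obtain T S where add: "\<And>x y. x \<in> V \<Longrightarrow> y \<in> V \<Longrightarrow> T (x + y) = T x + T y"
    and scale: "\<And>c x. x \<in> V \<Longrightarrow> T (c *\<^sub>R x) = c *\<^sub>R T x" and hom: "homeomorphism V W T S"
    using iso unfolding isomorphic_subspaces_def by blast
  have sub: "subspace V" and inf: "\<not> (\<exists>B. finite B \<and> span B = V)"
    using V by (auto simp: banach_subspace_def)
  obtain M where M: "M \<ge> 1" "\<And>x. x \<in> V \<Longrightarrow> norm (T x) \<le> M * norm x"
    "\<And>x. x \<in> V \<Longrightarrow> norm x \<le> M * norm (T x)"
    using isomorphism_bounds[OF sub add scale hom] by blast
  note nz = schauder_basis_nonzero[OF e(1)] schauder_basis_nonzero[OF e(2)]
  have \<epsilon>1: "\<epsilon> \<le> 1" using asymptotic_l1_le_1[OF as(1) nz(1)] .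
  \<comment> \<open>Both \<open>norm (v n) = 1\<close> and \<open>norm (T (v n)) \<ge> 1 / M\<close>
    are at least \<open>2 * c\<close>, so an error of at most \<open>c\<close> leaves
    \<open>u n\<close> and \<open>w n\<close> with norm at least \<open>c\<close>.\<close>
  define c where "c = 1 / (2 * M)"
  have c: "c > 0" using M(1) by (simp add: c_def)
  \<comment> \<open>This is the largest error that \<open>block_perturbation\<close> allows;
    \<epsilon> and \<open>c\<close> are common to its two applications.\<close>
  define \<eta> where "\<eta> = \<epsilon>\<^sup>2 * c / 2"
  have \<eta>: "\<eta> > 0" using c pos by (simp add: \<eta>_def)
  have "\<epsilon>\<^sup>2 * c \<le> 1 * c" using c \<epsilon>1 pos(1) by (intro mult_right_mono) (auto simp: power_le_one)
  then have \<eta>c: "\<eta> \<le> c" using c by (simp add: \<eta>_def)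
  obtain F :: "nat \<Rightarrow> nat set" and v u :: "nat \<Rightarrow> 'a" and w :: "nat \<Rightarrow> 'b" where
    F: "\<And>n. n \<ge> 1 \<Longrightarrow> finite (F n) \<and> F n \<noteq> {} \<and> F n \<subseteq> {2..} \<and> set_less (F n) (F (Suc n)) \<and>
       u n \<in> span (e ` F n)"
    and w: "\<And>n. n \<ge> 1 \<Longrightarrow> w n \<in> span (e' ` F n)"
    and v: "\<And>n. n \<ge> 1 \<Longrightarrow> v n \<in> V \<and> norm (v n) = 1"
    and uv: "\<And>n. n \<ge> 1 \<Longrightarrow> norm (u n - v n) \<le> \<eta> * (1/2) ^ n"
    and wv: "\<And>n. n \<ge> 1 \<Longrightarrow> norm (w n - T (v n)) \<le> \<eta> * (1/2) ^ n"
    by (rule common_block_sequences[where T = T, OF e sub inf _ _ \<eta>])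
      (erule (1) add | erule scale | (rule that; assumption))+
  have F': "finite (F n) \<and> F n \<noteq> {} \<and> F n \<subseteq> {2..} \<and> set_less (F n) (F (Suc n)) \<and>
       w n \<in> span (e' ` F n)" if "n \<ge> 1" for n using F w that by blast
  have "2 * c \<le> 1" using M(1) by (simp add: c_def)
  have small: "\<eta> * (1/2) ^ n \<le> c" for n :: nat
  proof -
    have "\<eta> * (1/2) ^ n \<le> \<eta> * 1" using \<eta> by (intro mult_left_mono power_le_one) auto
    then show ?thesis using \<eta>c by simp
  qed
  have cu: "c \<le> norm (u n)" if n: "n \<ge> 1" for n
    using norm_triangle_ineq2[of "v n" "v n - u n"] v[OF n] uv[OF n] small[of n] \<open>2 * c \<le> 1\<close>
    by (simp add: norm_minus_commute)
  have cw: "c \<le> norm (w n)" if n: "n \<ge> 1" for n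
  proof -
    have "2 * c \<le> norm (T (v n))" using M(3)[of "v n"] v[OF n] M(1) by (simp add: c_def field_simps)
    then show ?thesis
      using norm_triangle_ineq2[of "T (v n)" "T (v n) - w n"] wv[OF n] small[of n]
      by (simp add: norm_minus_commute)
  qed
  have T_sum: "(\<Sum>i\<in>G. b i *\<^sub>R v i) \<in> V \<and> T (\<Sum>i\<in>G. b i *\<^sub>R v i) = (\<Sum>i\<in>G. b i *\<^sub>R T (v i))"
    if "finite G" "G \<subseteq> {1..}" for G and b :: "nat \<Rightarrow> real"
    using that
  proof (induction G)
    case empty
    then show ?case using scale[of 0 0] sub by (simp add: subspace_0)
  next
    case (insert i G)
    then have "v i \<in> V" using v by simp
    then show ?case using insert sub by (simp add: add scale subspace_add subspace_scale)
  qed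
  \<comment> \<open>One factor 2 comes from passing from \<open>x\<close> to \<open>z\<close>, the
    factor \<open>M\<close> from \<open>T\<close>, and another 2 from passing from
    \<open>T z\<close> to \<open>y\<close>.\<close>
  have equiv: "norm x \<le> (4 * M) * norm y \<and> norm y \<le> (4 * M) * norm x"
    if xy: "(x, y) \<in> span ((\<lambda>k. (u k, w k)) ` {1..})" for x y
  proof -
    obtain G b where G: "finite G" "G \<subseteq> {1..}" and "(x, y) = (\<Sum>i\<in>G. b i *\<^sub>R (u i, w i))"
      using span_image_finite_sum[OF xy] by blast
    then have x: "x = (\<Sum>i\<in>G. b i *\<^sub>R u i)" and y: "y = (\<Sum>i\<in>G. b i *\<^sub>R w i)"
      by (simp_all add: prod_eq_iff fst_sum snd_sum)
    define z where "z = (\<Sum>i\<in>G. b i *\<^sub>R v i)"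
    have z: "z \<in> V" "T z = (\<Sum>i\<in>G. b i *\<^sub>R T (v i))" using T_sum[OF G] by (simp_all add: z_def)
    have "norm (x - z) \<le> norm x / 2" unfolding x z_def
      by (rule block_perturbation[OF as(1) pos(1,2) nz(1) F c cu uv _ G]) (simp_all add: \<eta>_def)
    then have xz: "norm x \<le> 2 * norm z" "norm z \<le> 2 * norm x"
      using norm_triangle_ineq2[of x z] norm_triangle_ineq2[of z x]
      by (simp_all add: norm_minus_commute)
    have "norm (y - T z) \<le> norm y / 2" unfolding y z(2)
      by (rule block_perturbation[OF as(2) pos(1,3) nz(2) F' c cw wv _ G]) (simp_all add: \<eta>_def)
    then have yz: "norm y \<le> 2 * norm (T z)" "norm (T z) \<le> 2 * norm y"
      using norm_triangle_ineq2[of y "T z"] norm_triangle_ineq2[of "T z" y]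
      by (simp_all add: norm_minus_commute)
    have "M * norm (T z) \<le> M * (2 * norm y)" "M * norm z \<le> M * (2 * norm x)"
      using M(1) xz yz by (simp_all add: mult_left_mono)
    then show ?thesis using xz yz M(2,3)[OF z(1)] by simp
  qed
  have "block_basis e u" "block_basis e' w"
    unfolding block_basis_iff
    by (rule exI[of _ F], use F F' cu cw c in fastforce)+
  then show thesis using that[of u w "4 * M"] equiv M(1) by simp
qed

section \<open>Transfer of spreading models and the contradiction\<close>

text \<open>The blocks \<open>x n\<close> of \<open>u\<close> have counterparts \<open>y n\<close>
  with the same coefficients over \<open>w\<close>, and the normalized \<open>y n\<close> form a
  block basis of \<open>e'\<close>. The constant \<open>C\<close> is paid twice:
  \<open>norm (y n)\<close> may be as small as \<open>1 / C\<close>, and the estimate for sums of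
  the \<open>y n\<close> has to be carried back to the \<open>x n\<close>.\<close>

lemma l1_spreading_model_transfer:
  assumes as: "asymptotic_l1 \<epsilon> \<xi> e'" and w: "block_basis e' w" and C: "C > 0"
    and equiv: "\<And>x y. (x, y) \<in> span ((\<lambda>k. (u k, w k)) ` {1..}) \<Longrightarrow>
        norm x \<le> C * norm y \<and> norm y \<le> C * norm x"
    and x: "block_basis u x" "normalized x" and \<theta>: "0 < \<theta>" "\<theta> \<le> \<epsilon> / C\<^sup>2"
  shows "l1_spreading_model \<theta> \<xi> x"
proof -
  obtain G a where G: "\<And>n. n \<ge> 1 \<Longrightarrow> finite (G n) \<and> G n \<noteq> {} \<and> G n \<subseteq> {1..} \<and>
      set_less (G n) (G (Suc n)) \<and> x n = (\<Sum>i\<in>G n. a i *\<^sub>R u i) \<and> x n \<noteq> 0"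
    using x(1) unfolding block_basis_def by blast
  define y where "y n = (\<Sum>i\<in>G n. a i *\<^sub>R w i)" for n
  define R where "R = span ((\<lambda>k. (u k, w k)) ` {1..})"
  have xy: "(x n, y n) \<in> R" if "n \<ge> 1" for n
  proof -
    have "(x n, y n) = (\<Sum>i\<in>G n. a i *\<^sub>R (u i, w i))"
      using G[OF that] by (simp add: prod_eq_iff fst_sum snd_sum y_def)
    then show ?thesis unfolding R_def using G[OF that] by (metis sum_mem_span_image subsetD)
  qed
  have y_lower: "1 / C \<le> norm (y n)" if "n \<ge> 1" for n
    using equiv xy[OF that] x(2) C that by (fastforce simp: R_def normalized_def field_simps)
  then have y0: "y n \<noteq> 0" if "n \<ge> 1" for n using that C by force
  have "block_basis w y" unfolding block_basis_def
    using G y0 by (intro exI[of _ G] exI[of _ a]) (simp add: y_def)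
  then have "block_basis e' (\<lambda>n. y n /\<^sub>R norm (y n))"
    by (intro block_basis_normalize block_basis_trans[OF w])
  moreover have "normalized (\<lambda>n. y n /\<^sub>R norm (y n))" using y0 by (simp add: normalized_def)
  ultimately have l1: "l1_spreading_model \<epsilon> \<xi> (\<lambda>n. y n /\<^sub>R norm (y n))"
    using as by (simp add: asymptotic_l1_def)
  then have "\<epsilon> > 0" by (simp add: l1_spreading_model_def)
  show ?thesis unfolding l1_spreading_model_def
  proof (intro conjI ballI allI \<theta>(1) x(2))
    fix F and b :: "nat \<Rightarrow> real" assume F: "F \<in> schreier \<xi>"
    have F1: "n \<ge> 1" if "n \<in> F" for n using schreier_pos[OF F] that by auto
    have "\<theta> * (\<Sum>i\<in>F. \<bar>b i\<bar>) \<le> (\<epsilon> / C\<^sup>2) * (\<Sum>i\<in>F. \<bar>b i\<bar>)"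
      using \<theta>(2) by (intro mult_right_mono) (auto intro: sum_nonneg)
    also have "\<dots> = (\<epsilon> / C) * (\<Sum>i\<in>F. \<bar>b i\<bar> * (1 / C))"
      by (simp add: sum_distrib_left[symmetric] sum_divide_distrib[symmetric] power2_eq_square)
    also have "\<dots> \<le> (\<epsilon> / C) * (\<Sum>i\<in>F. \<bar>b i * norm (y i)\<bar>)"
    proof (intro mult_left_mono sum_mono)
      fix i assume "i \<in> F"
      then have "\<bar>b i\<bar> * (1 / C) \<le> \<bar>b i\<bar> * norm (y i)"
        by (intro mult_left_mono y_lower F1) auto
      then show "\<bar>b i\<bar> * (1 / C) \<le> \<bar>b i * norm (y i)\<bar>" by (simp add: abs_mult)
    qed (use \<open>\<epsilon> > 0\<close> C in simp)
    also have "\<dots> \<le> norm (\<Sum>i\<in>F. (b i * norm (y i)) *\<^sub>R (y i /\<^sub>R norm (y i))) / C"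
    proof -
      have "\<epsilon> * (\<Sum>i\<in>F. \<bar>b i * norm (y i)\<bar>) \<le> norm (\<Sum>i\<in>F. (b i * norm (y i)) *\<^sub>R (y i /\<^sub>R norm (y i)))"
        using l1 F unfolding l1_spreading_model_def by fast
      then show ?thesis using C by (simp add: divide_right_mono)
    qed
    also have "(\<Sum>i\<in>F. (b i * norm (y i)) *\<^sub>R (y i /\<^sub>R norm (y i))) = (\<Sum>i\<in>F. b i *\<^sub>R y i)"
      using y0 F1 by (intro sum.cong) auto
    also have "norm (\<Sum>i\<in>F. b i *\<^sub>R y i) / C \<le> norm (\<Sum>i\<in>F. b i *\<^sub>R x i)"
    proof -
      have "(\<Sum>i\<in>F. b i *\<^sub>R (x i, y i)) \<in> R"
        unfolding R_def by (intro span_sum span_scale) (use xy F1 in \<open>auto simp: R_def\<close>)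
      moreover have "(\<Sum>i\<in>F. b i *\<^sub>R (x i, y i)) = (\<Sum>i\<in>F. b i *\<^sub>R x i, \<Sum>i\<in>F. b i *\<^sub>R y i)"
        by (simp add: prod_eq_iff fst_sum snd_sum)
      ultimately show ?thesis using equiv C by (simp add: R_def field_simps)
    qed
    finally show "\<theta> * (\<Sum>i\<in>F. \<bar>b i\<bar>) \<le> norm (\<Sum>i\<in>F. b i *\<^sub>R x i)" .
  qed
qed

theorem proposition3p3:
  fixes e1 :: "nat \<Rightarrow> 'a::banach" and e2 :: "nat \<Rightarrow> 'b::banach"
    and n1 p1 n2 p2 :: "nat \<Rightarrow> nat"
    and \<delta> :: "nat \<Rightarrow> real" and d1 d2 :: real
  assumes "shrinking_basis e1" and "shrinking_basis e2"
    and "distortion_property d1 n1 p1 \<delta> e1"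
    and "distortion_property d2 n2 p2 \<delta> e2"
    and "(\<lambda>i. \<delta> (Suc i) / \<delta> i) \<longlonglongrightarrow> 0"
    and "\<forall>i0. \<exists>i j. i > j \<and> j > i0 \<and> n1 i = n2 j"
  shows "totally_incomparable TYPE('a) TYPE('b)"
  unfolding totally_incomparable_def
proof (intro notI, elim exE conjE)
  fix V :: "'a set" and W :: "'b set"
  assume VW: "banach_subspace V" "isomorphic_subspaces V W"
  have e: "schauder_basis e1" "schauder_basis e2"
    using assms(1,2) by (simp_all add: shrinking_basis_def)
  note D1 = assms(3)[unfolded distortion_property_def]
  note D2 = assms(4)[unfolded distortion_property_def]
  \<comment> \<open>Index 1 supplies the estimates for the perturbation argument. Thus
    \<open>C\<close> is fixed before \<open>i\<close> and \<open>j\<close> are chosen.\<close>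
  have "asymptotic_l1 (\<delta> 1) (n1 1) e1" "asymptotic_l1 (\<delta> 1) (n2 1) e2" "\<delta> 1 > 0" "n1 1 \<ge> 1" "n2 1 \<ge> 1"
    using D1 D2 by blast+
  from equivalent_block_bases[OF e this VW]
  obtain u w C where u: "block_basis e1 u" and w: "block_basis e2 w" and C: "C > 0"
    and equiv: "\<And>x y. (x, y) \<in> span ((\<lambda>k. (u k, w k)) ` {1..}) \<Longrightarrow>
        norm x \<le> C * norm y \<and> norm y \<le> C * norm x" by blast
  have "d1 > 1" using D1 by blast
  \<comment> \<open>This threshold makes one step of \<delta> beyond \<open>i0\<close> absorb both
    the factor \<open>d1\<close> and the loss \<open>C\<^sup>2\<close> of the transfer.\<close>
  then have "1 / (d1 * C\<^sup>2) > 0" using C by simp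
  from LIMSEQ_D[OF assms(5) this]
  obtain i0 where i0: "\<And>i. i \<ge> i0 \<Longrightarrow> \<bar>\<delta> (Suc i) / \<delta> i\<bar> < 1 / (d1 * C\<^sup>2)" by auto
  obtain i j where ij: "i > j" "j > i0" "n1 i = n2 j" using assms(6) by blast
  have pos: "\<delta> k > 0" if "k \<ge> 1" for k using D1 that by blast
  have "antimono_on {1..} \<delta>" using D1 by blast
  \<comment> \<open>Here \<open>i > j\<close> enters: \<open>i\<close> is at least
    \<open>Suc j\<close>, so the gain from one step of \<delta> is inherited by
    \<open>\<delta> i\<close>.\<close>
  then have "\<delta> i \<le> \<delta> (Suc j)" using ij by (auto elim!: monotone_onD)
  moreover have "\<delta> (Suc j) \<le> \<delta> j / (d1 * C\<^sup>2)"
    using i0[of j] ij pos[of j] pos[of "Suc j"] by (simp add: divide_less_eq)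
  ultimately have "d1 * \<delta> i \<le> d1 * (\<delta> j / (d1 * C\<^sup>2))"
    using \<open>d1 > 1\<close> by (intro mult_left_mono) auto
  also have "\<dots> = \<delta> j / C\<^sup>2" using \<open>d1 > 1\<close> by simp
  finally have \<theta>: "d1 * \<delta> i \<le> \<delta> j / C\<^sup>2" .
  \<comment> \<open>By \<open>n1 i = n2 j\<close>, the order given by \<open>e2\<close> with the
    larger constant \<open>\<delta> j\<close> is the order attached to \<open>\<delta> i\<close> in
    \<open>e1\<close>.\<close>
  have as: "asymptotic_l1 (\<delta> j) (n1 i) e2" using D2 ij by simp
  have "0 < d1 * \<delta> i" using \<open>d1 > 1\<close> pos[of i] ij by simp
  \<comment> \<open>The whole sequence already has the property, so \<open>id\<close> serves as the
    subsequence demanded by \<open>tau\<close>.\<close>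
  then have "l1_spreading_model (d1 * \<delta> i) (n1 i) (x \<circ> id)" if "block_basis u x" "normalized x" for x
    using l1_spreading_model_transfer[OF as w C equiv that _ \<theta>] by simp
  then have "enat (n1 i) \<le> tau u (d1 * \<delta> i)"
    unfolding tau_def by (intro SUP_upper CollectI allI impI exI[of _ id]) (auto simp: strict_mono_def)
  also have "\<dots> < enat (p1 i)" using D1 u ij by simp
  finally have "n1 i < p1 i" by simp
  moreover have "real (p1 i) < real (n1 i) / 2" using D1 ij(1) by simp
  ultimately show False by linarith
qed

end
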